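(* Let $\mathcal{P}=\{\bm x\in\mathbb{R}^K:\bm S\bm x\le\bm t\}$, with $\bm S\in\mathbb{R}^{J\times K}$ and $\bm t\in\mathbb{R}^J$, be compact, convex and full-dimensional. Let $\bm Q\in\mathbb{S}^K_{++}$, $\bm q\in\mathbb{R}^K$ and let $\mathcal{E}(\bm Q,\bm q)=\{\bm x\in\mathbb{R}^K:\|\bm Q\bm x+\bm q\|^2\le1\}$ be an ellipsoid containing $\mathcal{P}$ whose center lies inside $\mathcal{P}$. Then, for the set $\{\bm x\in\mathbb{R}^K:\bm S\bm x\le\bm t,\ \|\bm Q\bm x+\bm q\|^2\le1\}$, the ellipsoid $\mathcal{E}_{\mathrm{sproc}}$ produced by the $\mathcal{S}$-procedure approximation (defined in the context) satisfies $\mathcal{E}_{\mathrm{sproc}}=\mathcal{E}(\bm Q,\bm q)$.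
   Context: $\mathbb{S}^K$, $\mathbb{S}^K_{++}$ are the real symmetric and symmetric positive definite $K\times K$ matrices; $\mathbb{R}_+^J$ is the nonnegative orthant; $\mathbb{I}$ is the identity; $\|\cdot\|$ is the Euclidean norm; $\succeq\bm 0$ means symmetric positive semidefinite. Full-dimensional means having nonempty interior. The center of $\mathcal{E}(\bm Q,\bm q)$ is $-\bm Q^{-1}\bm q$. Two ellipsoids $\mathcal{E}(\bm A_1,\bm b_1)$, $\mathcal{E}(\bm A_2,\bm b_2)$ with $\bm A_1,\bm A_2\in\mathbb{S}^K_{++}$ are called equal iff $\bm A_1=\bm A_2$ and $\bm b_1=\bm b_2$. For the set $\{\bm x:\bm S\bm x\le\bm t,\ \|\bm Q\bm x+\bm q\|^2\le1\}$, the $\mathcal{S}$-procedure approximation is the optimization problem: minimize $-\log\det(\bm A)$ (which equals $+\infty$ unless $\bm A$ is positive definite) over $\bm A\in\mathbb{S}^K$, $\bm b\in\mathbb{R}^K$, $\bm\mu\in\mathbb{R}_+^J$, $\lambda\in\mathbb{R}_+$ subject to $$\begin{bmatrix}\bm 0&\tfrac12\bm S^\top\bm\mu&\bm A\\ \tfrac12\bm\mu^\top\bm S&1-\bm\mu^\top\bm t&\bm b^\top\\ \bm A&\bm b&\mathbb{I}\end{bmatrix}+\lambda\begin{bmatrix}\bm Q^2&\bm Q\bm q&\bm 0\\ \bm q^\top\bm Q&\bm q^\top\bm q-1&\bm 0\\ \bm 0&\bm 0&\bm 0\end{bmatrix}\succeq\bm 0.$$ $\mathcal{E}_{\mathrm{sproc}}$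 denotes the ellipsoid $\mathcal{E}(\bm A,\bm b)$ given by an optimal solution of this problem; the assertion $\mathcal{E}_{\mathrm{sproc}}=\mathcal{E}(\bm Q,\bm q)$ means that $(\bm A,\bm b)=(\bm Q,\bm q)$ is the unique optimal choice of $(\bm A,\bm b)$. *)

theory Defs
  imports "HOL-Analysis.Analysis"
begin

definition symmetric_matrix :: "real^'n^'n \<Rightarrow> bool" where
  "symmetric_matrix M \<longleftrightarrow> transpose M = M"

definition pos_semidef :: "real^'n^'n \<Rightarrow> bool" where
  "pos_semidef M \<longleftrightarrow> symmetric_matrix M \<and> (\<forall>x. 0 \<le> x \<bullet> (M *v x))"

definition pos_def :: "real^'n^'n \<Rightarrow> bool" where
  "pos_def M \<longleftrightarrow> symmetric_matrix M \<and> (\<forall>x. x \<noteq> 0 \<longrightarrow> 0 < x \<bullet> (M *v x))"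

text \<open>The order on vectors is the componentwise one.\<close>

definition polytope_ineq :: "real^'k^'j \<Rightarrow> real^'j \<Rightarrow> (real^'k) set" where
  "polytope_ineq S t = {x. S *v x \<le> t}"

definition ellipsoid :: "real^'k^'k \<Rightarrow> real^'k \<Rightarrow> (real^'k) set" where
  "ellipsoid Q q = {x. (norm (Q *v x + q))\<^sup>2 \<le> 1}"

definition ellipsoid_center :: "real^'k^'k \<Rightarrow> real^'k \<Rightarrow> real^'k" where
  "ellipsoid_center Q q = - (matrix_inv Q *v q)"

text \<open>The \<open>(K + 1 + K) \<times> (K + 1 + K)\<close> matrix given by its nine blocks, in row-major
  order. The index type \<open>'k + unit + 'k\<close> associates to the right, so the three index
  groups are \<open>Inl i\<close>, \<open>Inr (Inl ())\<close> and \<open>Inr (Inr i)\<close>; column and row blocks of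
  width one are both given as vectors.\<close>

definition block3 ::
  "real^'k^'k \<Rightarrow> real^'k \<Rightarrow> real^'k^'k \<Rightarrow>
   real^'k \<Rightarrow> real \<Rightarrow> real^'k \<Rightarrow>
   real^'k^'k \<Rightarrow> real^'k \<Rightarrow> real^'k^'k \<Rightarrow>
   real^('k + unit + 'k)^('k + unit + 'k)" where
  "block3 M11 v12 M13 v21 c22 v23 M31 v32 M33 = (\<chi> r c.
     case r of
       Inl i \<Rightarrow>
         (case c of Inl j \<Rightarrow> M11 $ i $ j | Inr (Inl _) \<Rightarrow> v12 $ i | Inr (Inr j) \<Rightarrow> M13 $ i $ j)
     | Inr (Inl _) \<Rightarrow>
         (case c of Inl j \<Rightarrow> v21 $ j | Inr (Inl _) \<Rightarrow> c22 | Inr (Inr j) \<Rightarrow> v23 $ j)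
     | Inr (Inr i) \<Rightarrow>
         (case c of Inl j \<Rightarrow> M31 $ i $ j | Inr (Inl _) \<Rightarrow> v32 $ i | Inr (Inr j) \<Rightarrow> M33 $ i $ j))"

definition sproc_matrix ::
  "real^'k^'j \<Rightarrow> real^'j \<Rightarrow> real^'k^'k \<Rightarrow> real^'k \<Rightarrow>
   real^'k^'k \<Rightarrow> real^'k \<Rightarrow> real^'j \<Rightarrow> real \<Rightarrow>
   real^('k + unit + 'k)^('k + unit + 'k)" where
  "sproc_matrix S t Q q A b mu lam =
     block3
       0                         ((1/2) *\<^sub>R (transpose S *v mu))   A
       ((1/2) *\<^sub>R (mu v* S))   (1 - mu \<bullet> t)                    b
       A                         b                                 (mat 1)
     + lam *\<^sub>R block3
       (Q ** Q)   (Q *v q)      0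
       (q v* Q)   (q \<bullet> q - 1)   0
       0          0             0"

definition sproc_feasible ::
  "real^'k^'j \<Rightarrow> real^'j \<Rightarrow> real^'k^'k \<Rightarrow> real^'k \<Rightarrow>
   real^'k^'k \<Rightarrow> real^'k \<Rightarrow> real^'j \<Rightarrow> real \<Rightarrow> bool" where
  "sproc_feasible S t Q q A b mu lam \<longleftrightarrow>
     symmetric_matrix A \<and> 0 \<le> mu \<and> 0 \<le> lam \<and>
     pos_semidef (sproc_matrix S t Q q A b mu lam)"

definition neg_log_det :: "real^'k^'k \<Rightarrow> ereal" where
  "neg_log_det A = (if pos_def A then ereal (- ln (det A)) else \<infinity>)"

definition sproc_optimal ::
  "real^'k^'j \<Rightarrow> real^'j \<Rightarrow> real^'k^'k \<Rightarrow> real^'k \<Rightarrow>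
   real^'k^'k \<Rightarrow> real^'k \<Rightarrow> real^'j \<Rightarrow> real \<Rightarrow> bool" where
  "sproc_optimal S t Q q A b mu lam \<longleftrightarrow>
     sproc_feasible S t Q q A b mu lam \<and>
     (\<forall>A' b' mu' lam'. sproc_feasible S t Q q A' b' mu' lam' \<longrightarrow> neg_log_det A \<le> neg_log_det A')"

text \<open>Ellipsoids are compared through their parameters, so the ellipsoid produced by the
  approximation is represented by the set of pairs \<open>(A, b)\<close> occurring in an optimal
  solution; it is well defined exactly when this set is a singleton.\<close>

definition sproc_ellipsoids ::
  "real^'k^'j \<Rightarrow> real^'j \<Rightarrow> real^'k^'k \<Rightarrow> real^'k \<Rightarrow> ((real^'k^'k) \<times> (real^'k)) set" where
  "sproc_ellipsoids S t Q q = {(A, b). \<exists>mu lam. sproc_optimal S t Q q A b mu lam}"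

end

theory Submission
  imports Defs
begin

text \<open>A Schur complement turns the matrix inequality into the quadratic inequality
  \<open>\<parallel>A x + s b\<parallel>\<^sup>2 \<le> s (\<mu> \<bullet> S x) + s\<^sup>2 (1 - \<mu> \<bullet> t) + \<lambda> (\<parallel>Q x + s q\<parallel>\<^sup>2 - s\<^sup>2)\<close>. At the center of the
  ellipsoid, which satisfies \<open>S c \<le> t\<close>, it gives \<open>\<lambda> + \<parallel>A c + b\<parallel>\<^sup>2 \<le> 1\<close>; at \<open>s = 0\<close> it gives
  \<open>\<parallel>A x\<parallel>\<^sup>2 \<le> \<lambda> \<parallel>Q x\<parallel>\<^sup>2 \<le> \<parallel>Q x\<parallel>\<^sup>2\<close>. So \<open>A Q\<^sup>-\<^sup>1\<close> is a contraction, and Hadamard's inequality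
  yields \<open>det A \<le> det Q\<close>. In case of equality the contraction is an isometry, whence \<open>A\<^sup>2 = Q\<^sup>2\<close> and
  \<open>A = Q\<close>; then \<open>\<lambda> = 1\<close> and \<open>b = - Q c = q\<close>. The pair \<open>(Q, q)\<close> itself is feasible with \<open>\<mu> = 0\<close> and
  \<open>\<lambda> = 1\<close>.\<close>

lemma symmetric_matrix_inner:
  fixes M :: "real^'n^'n"
  assumes "symmetric_matrix M"
  shows "(M *v x) \<bullet> y = x \<bullet> (M *v y)"
  using assms unfolding symmetric_matrix_def
  by (metis dot_lmul_matrix vector_transpose_matrix)

section \<open>Hadamard's inequality\<close>

lemma det_orthogonal_rows:
  fixes A :: "real^'n^'n"
  assumes "\<And>i j. i \<noteq> j \<Longrightarrow> A $ i \<bullet> A $ j = 0"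
  shows "\<bar>det A\<bar> = (\<Prod>i\<in>UNIV. norm (A $ i))"
proof -
  have ent: "(A ** transpose A) $ i $ j = A $ i \<bullet> A $ j" for i j
    by (simp add: matrix_matrix_mult_def transpose_def inner_vec_def)
  have "(det A)\<^sup>2 = det (A ** transpose A)"
    by (simp add: det_mul power2_eq_square)
  also have "\<dots> = (\<Prod>i\<in>UNIV. (norm (A $ i))\<^sup>2)"
    by (subst det_diagonal) (use assms in \<open>simp_all add: ent power2_norm_eq_inner\<close>)
  also have "\<dots> = (\<Prod>i\<in>UNIV. norm (A $ i))\<^sup>2"
    by (simp add: prod_power_distrib)
  finally have "\<bar>det A\<bar> = \<bar>\<Prod>i\<in>UNIV. norm (A $ i)\<bar>"
    by (simp add: power2_eq_iff abs_eq_iff)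
  then show ?thesis
    by (simp add: abs_of_nonneg prod_nonneg)
qed

text \<open>Gram-Schmidt without normalisation, one row per induction step: each new row is replaced
  by its component orthogonal to the rows already treated, which is never longer.\<close>

lemma exists_orthogonal_rows:
  fixes A :: "real^'n^'n" and T :: "'n set"
  shows "\<exists>A'. det A' = det A \<and> (\<forall>i. norm (A' $ i) \<le> norm (A $ i)) \<and>
    (\<forall>i\<in>T. \<forall>j\<in>T. i \<noteq> j \<longrightarrow> A' $ i \<bullet> A' $ j = 0)"
proof (induction T rule: finite_induct[OF finite])
  case 1
  show ?case by (intro exI[of _ A]) simp
next
  case (2 k T)
  then obtain M where M: "det M = det A" "\<And>i. norm (M $ i) \<le> norm (A $ i)"
    and orth: "\<And>i j. i \<in> T \<Longrightarrow> j \<in> T \<Longrightarrow> i \<noteq> j \<Longrightarrow> M $ i \<bullet> M $ j = 0"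
    by blast
  obtain y z where y: "y \<in> span ((\<lambda>j. M $ j) ` T)"
    and z: "\<And>w. w \<in> span ((\<lambda>j. M $ j) ` T) \<Longrightarrow> orthogonal z w" and yz: "M $ k = y + z"
    using orthogonal_subspace_decomp_exists by blast
  \<comment> \<open>Subtracting from row \<open>k\<close> a combination of the rows in
    \<open>T\<close> keeps the determinant, because \<open>k\<close> is not in
    \<open>T\<close>.\<close>
  define M' where "M' = (\<chi> i. if i = k then row k M + (- y) else row i M)"
  have "(\<lambda>j. M $ j) ` T \<subseteq> {row j M |j. j \<noteq> k}"
    using 2 by (auto simp: row_def vec_eq_iff)
  then have "- y \<in> span {row j M |j. j \<noteq> k}"
    using y span_mono span_neg by blast
  then have det: "det M' = det M"
    unfolding M'_def using det_row_span[of "- y" M k] by (simp add: span_vec_eq)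
  have M'k: "M' $ k = z" and M'j: "\<And>j. j \<noteq> k \<Longrightarrow> M' $ j = M $ j"
    by (simp_all add: M'_def row_def yz vec_eq_iff)
  have "(norm (M $ k))\<^sup>2 = (norm y)\<^sup>2 + (norm z)\<^sup>2"
    unfolding yz using z[OF y] by (simp add: norm_add_Pythagorean orthogonal_commute)
  then have "norm z \<le> norm (M $ k)"
    by (simp add: power2_le_imp_le)
  then have norms: "norm (M' $ i) \<le> norm (A $ i)" for i
    using M(2)[of i] by (cases "i = k") (auto simp: M'k M'j)
  have zT: "z \<bullet> M $ j = 0" if "j \<in> T" for j
    using z[of "M $ j"] that by (simp add: span_base orthogonal_def)
  have "M' $ i \<bullet> M' $ j = 0" if "i \<in> insert k T" "j \<in> insert k T" "i \<noteq> j" for i j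
    using that zT orth by (cases "i = k"; cases "j = k") (auto simp: M'k M'j inner_commute)
  then show ?case
    using det M(1) norms by metis
qed

lemma hadamard_inequality:
  fixes A :: "real^'n^'n"
  shows "\<bar>det A\<bar> \<le> (\<Prod>i\<in>UNIV. norm (A $ i))"
proof -
  obtain A' where A': "det A' = det A" "\<And>i. norm (A' $ i) \<le> norm (A $ i)"
    "\<And>i j. i \<noteq> j \<Longrightarrow> A' $ i \<bullet> A' $ j = 0"
    using exists_orthogonal_rows[of A UNIV] by auto
  have "\<bar>det A\<bar> = (\<Prod>i\<in>UNIV. norm (A' $ i))"
    using det_orthogonal_rows[of A'] A' by simp
  also have "\<dots> \<le> (\<Prod>i\<in>UNIV. norm (A $ i))"
    by (intro prod_mono) (simp add: A')
  finally show ?thesis .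
qed

lemma abs_det_le_prod_columns:
  fixes A :: "real^'n^'n"
  shows "\<bar>det A\<bar> \<le> (\<Prod>i\<in>UNIV. norm (A *v axis i 1))"
proof -
  have "transpose A $ i = A *v axis i 1" for i
    by (simp add: matrix_vector_mult_basis column_def transpose_def vec_eq_iff)
  then show ?thesis
    using hadamard_inequality[of "transpose A"] by simp
qed

section \<open>Determinants of contractions\<close>

lemma abs_det_contraction:
  fixes B :: "real^'n^'n"
  assumes "\<And>x. norm (B *v x) \<le> norm x"
  shows "\<bar>det B\<bar> \<le> 1"
proof -
  have "norm (B *v axis i 1) \<le> 1" for i
    using assms[of "axis i 1"] by simp
  then have "(\<Prod>i\<in>UNIV. norm (B *v axis i 1)) \<le> 1"
    by (intro prod_le_1) simp
  then show ?thesis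
    using abs_det_le_prod_columns[of B] by linarith
qed

text \<open>If the norm of \<open>y\<close> shrinks, rotating a coordinate axis onto \<open>y\<close> makes one column
  shorter than \<open>1\<close>, and Hadamard's inequality becomes strict.\<close>

lemma contraction_abs_det_1_isometry:
  fixes B :: "real^'n^'n"
  assumes contr: "\<And>x. norm (B *v x) \<le> norm x" and det: "\<bar>det B\<bar> = 1"
  shows "norm (B *v y) = norm y"
proof (rule ccontr)
  assume "norm (B *v y) \<noteq> norm y"
  then have less: "norm (B *v y) < norm y"
    using contr[of y] by simp
  fix k :: 'n
  define u where "u = y /\<^sub>R norm y"
  have "y \<noteq> 0" using less by auto
  then have u1: "norm u = 1" by (simp add: u_def)
  have Bu: "norm (B *v u) < 1"
    using less \<open>y \<noteq> 0\<close> by (simp add: u_def matrix_vector_mult_scaleR divide_simps)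
  obtain f :: "real^'n \<Rightarrow> real^'n" where f: "orthogonal_transformation f" "f (axis k 1) = u"
    using orthogonal_transformation_exists_1[OF norm_axis_1[of k] u1] by blast
  define F where "F = matrix f"
  have Fv: "F *v x = f x" for x
    using f(1) by (simp add: F_def orthogonal_transformation_linear)
  have Fn: "norm (F *v x) = norm x" for x
    using f(1) by (simp add: Fv orthogonal_transformation_norm)
  have "\<bar>det F\<bar> = 1"
    using f(1) by (simp add: F_def)
  then have "1 = \<bar>det (B ** F)\<bar>"
    using det by (simp add: det_mul abs_mult)
  also have "\<dots> \<le> (\<Prod>i\<in>UNIV. norm (B *v (F *v axis i 1)))"
    using abs_det_le_prod_columns[of "B ** F"] by (simp add: matrix_vector_mul_assoc)
  also have "\<dots> = norm (B *v (F *v axis k 1)) * (\<Prod>i\<in>UNIV - {k}. norm (B *v (F *v axis i 1)))"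
    by (simp add: prod.remove)
  also have "\<dots> \<le> norm (B *v (F *v axis k 1)) * 1"
  proof (intro mult_left_mono prod_le_1)
    fix i
    show "0 \<le> norm (B *v (F *v axis i 1)) \<and> norm (B *v (F *v axis i 1)) \<le> 1"
      using contr[of "F *v axis i 1"] by (simp add: Fn)
  qed simp
  also have "\<dots> < 1"
    using Bu by (simp add: Fv f(2))
  finally show False by simp
qed

section \<open>Positive definite matrices: determinant and square roots\<close>

lemma pos_def_invertible:
  fixes A :: "real^'n^'n"
  assumes "pos_def A"
  shows "invertible A"
proof -
  have "x = 0" if "A *v x = 0" for x
    using assms that unfolding pos_def_def by (metis inner_zero_right less_irrefl)
  then show ?thesis
    using matrix_left_invertible_ker[of A] by (auto simp: invertible_left_inverse)
qed

lemma invertible_matrix_inv: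
  fixes A :: "real^'n^'n"
  assumes "invertible A"
  shows "A ** matrix_inv A = mat 1" "matrix_inv A ** A = mat 1"
proof -
  have "A ** matrix_inv A = mat 1 \<and> matrix_inv A ** A = mat 1"
    using assms unfolding invertible_def matrix_inv_def by (rule someI_ex)
  then show "A ** matrix_inv A = mat 1" "matrix_inv A ** A = mat 1" by simp_all
qed

text \<open>Joins the identity to \<open>A\<close> by a path of positive definite matrices, along
  which the determinant cannot vanish.\<close>

lemma pos_def_segment:
  fixes A :: "real^'n^'n"
  assumes "pos_def A" "0 \<le> s" "s \<le> 1"
  shows "pos_def ((1 - s) *\<^sub>R mat 1 + s *\<^sub>R A)"
proof -
  have "0 < (1 - s) * (x \<bullet> x) + s * (x \<bullet> (A *v x))" if "x \<noteq> 0" for x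
  proof (cases "s = 0")
    case False
    then have "0 < s * (x \<bullet> (A *v x))"
      using assms that by (simp add: pos_def_def)
    moreover have "0 \<le> (1 - s) * (x \<bullet> x)"
      using assms by simp
    ultimately show ?thesis by linarith
  qed (use that in simp)
  moreover have "transpose A = A"
    using assms(1) by (simp add: pos_def_def symmetric_matrix_def)
  then have "A $ i $ j = A $ j $ i" for i j
    by (metis transpose_def vec_lambda_beta)
  ultimately show ?thesis
    by (auto simp: pos_def_def symmetric_matrix_def matrix_vector_mult_add_rdistrib
        scaleR_matrix_vector_assoc[symmetric] inner_add_right transpose_def)
      (simp_all add: vec_eq_iff mat_def)
qed

text \<open>The determinant is 1 at the identity end of the segment, so a nonpositive
  \<open>det A\<close> would force a zero on the way, at an invertible matrix.\<close>

lemma pos_def_det_pos: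
  fixes A :: "real^'n^'n"
  assumes "pos_def A"
  shows "0 < det A"
proof (rule ccontr)
  assume neg: "\<not> 0 < det A"
  define g where "g s = det ((1 - s) *\<^sub>R mat 1 + s *\<^sub>R A)" for s :: real
  have "continuous_on {0..1} g"
    unfolding g_def det_def by (simp add: mat_def) (intro continuous_intros)
  then obtain s where "0 \<le> s" "s \<le> 1" "g s = 0"
    using IVT2'[of g 1 0 0] neg by (auto simp: g_def)
  then show False
    using pos_def_invertible[OF pos_def_segment[OF assms]] by (auto simp: g_def invertible_det_nz)
qed

lemma pos_def_inner_eq_0:
  assumes "pos_def A" "x \<bullet> (A *v x) = 0"
  shows "x = 0"
  using assms unfolding pos_def_def by (metis less_irrefl)

lemma pos_def_inner_nonneg:
  assumes "pos_def A"
  shows "0 \<le> x \<bullet> (A *v x)"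
  using assms unfolding pos_def_def by (cases "x = 0") (auto intro: less_imp_le)

text \<open>Writes the trace as a sum of values of the quadratic form of \<open>A\<close>; for
  positive definite \<open>A\<close> it is thus nonnegative, and zero only if \<open>D\<close> kills
  every basis vector.\<close>

lemma trace_conj_symmetric:
  fixes A D :: "real^'n^'n"
  assumes "symmetric_matrix D"
  shows "trace (D ** A ** D) = (\<Sum>i\<in>UNIV. (D *v axis i 1) \<bullet> (A *v (D *v axis i 1)))"
proof -
  have "(D ** A ** D) $ i $ i = (D *v axis i 1) \<bullet> (A *v (D *v axis i 1))" for i
  proof -
    have "(D ** A ** D) $ i $ i = axis i 1 \<bullet> ((D ** A ** D) *v axis i 1)"
      by (simp add: inner_axis' matrix_vector_mult_basis column_def)
    then show ?thesis
      by (simp add: symmetric_matrix_inner[OF assms] matrix_vector_mul_assoc matrix_mul_assoc)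
  qed
  then show ?thesis by (simp add: trace_def)
qed

text \<open>With \<open>D = A - C\<close>, equal squares give \<open>A D + D C = 0\<close>, so the traces of the positive
  semidefinite matrices \<open>D A D\<close> and \<open>D C D\<close> add up to zero.\<close>

lemma pos_def_square_inject:
  fixes A C :: "real^'n^'n"
  assumes A: "pos_def A" and C: "pos_def C" and sq: "A ** A = C ** C"
  shows "A = C"
proof -
  define D where "D = A - C"
  have symD: "symmetric_matrix D"
    using A C by (simp add: D_def pos_def_def symmetric_matrix_def transpose_def vec_eq_iff)
  have zero: "A ** D + D ** C = 0"
    by (simp add: D_def matrix_eq matrix_vector_mult_add_rdistrib matrix_vector_mult_diff_rdistrib
        matrix_vector_mult_diff_distrib matrix_vector_mul_assoc[symmetric])
      (simp add: matrix_vector_mul_assoc sq)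
  have "D ** A ** D + D ** D ** C = D ** (A ** D + D ** C)"
    by (simp add: matrix_add_ldistrib matrix_mul_assoc)
  then have "trace (D ** A ** D) + trace (D ** D ** C) = 0"
    by (simp add: zero trace_add[symmetric]) (simp add: trace_def)
  \<comment> \<open>Cyclicity of the trace brings the second summand into the same conjugated form
    as the first.\<close>
  moreover have "trace (D ** D ** C) = trace (D ** C ** D)"
    using trace_mul_sym[of D "D ** C"] by (simp add: matrix_mul_assoc)
  ultimately have sum0: "trace (D ** A ** D) + trace (D ** C ** D) = 0" by simp
  have "trace (D ** A ** D) \<ge> 0" "trace (D ** C ** D) \<ge> 0"
    by (simp_all add: trace_conj_symmetric[OF symD] sum_nonneg pos_def_inner_nonneg A C)
  with sum0 have "trace (D ** A ** D) = 0" by simp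
  then have "(D *v axis i 1) \<bullet> (A *v (D *v axis i 1)) = 0" for i
    by (simp add: trace_conj_symmetric[OF symD] sum_nonneg_eq_0_iff pos_def_inner_nonneg A)
  then have "D *v axis i 1 = 0" for i
    using pos_def_inner_eq_0[OF A] by blast
  then have "D = 0"
    by (simp add: matrix_vector_mult_basis column_def vec_eq_iff)
  then show ?thesis by (simp add: D_def)
qed

section \<open>Determinants of \<open>A\<close> and \<open>Q\<close> under pointwise norm
  comparison\<close>

context
  fixes A Q :: "real^'n^'n"
  assumes A: "pos_def A" and Q: "pos_def Q"
    and le: "\<And>x. norm (A *v x) \<le> norm (Q *v x)"
begin

private lemma quotient_contraction: "norm ((A ** matrix_inv Q) *v x) \<le> norm x"
  using le[of "matrix_inv Q *v x"] invertible_matrix_inv[OF pos_def_invertible[OF Q]]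
  by (simp add: matrix_vector_mul_assoc)

private lemma quotient_mult: "(A ** matrix_inv Q) ** Q = A"
  by (simp add: invertible_matrix_inv[OF pos_def_invertible[OF Q]] matrix_mul_assoc[symmetric])

private lemma det_quotient: "det (A ** matrix_inv Q) * det Q = det A"
  by (metis det_mul quotient_mult)

lemma pos_def_det_mono: "det A \<le> det Q"
proof -
  have "det (A ** matrix_inv Q) \<le> 1"
    using abs_det_contraction[OF quotient_contraction] by linarith
  then show ?thesis
    using mult_right_mono[of "det (A ** matrix_inv Q)" 1 "det Q"] det_quotient pos_def_det_pos[OF Q]
    by simp
qed

lemma pos_def_det_eq_imp_eq:
  assumes "det A = det Q"
  shows "A = Q"
proof -
  have "det (A ** matrix_inv Q) = 1"
    using det_quotient assms pos_def_det_pos[OF Q] by simp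
  then have iso: "norm ((A ** matrix_inv Q) *v x) = norm x" for x
    using contraction_abs_det_1_isometry[OF quotient_contraction] by simp
  have "norm (A *v x) = norm (Q *v x)" for x
    using iso[of "Q *v x"] by (simp add: matrix_vector_mul_assoc quotient_mult)
  then have quad: "(A *v x) \<bullet> (A *v x) = (Q *v x) \<bullet> (Q *v x)" for x
    by (simp add: norm_eq)
  \<comment> \<open>Polarization: equal quadratic forms have equal bilinear forms.\<close>
  have "(A *v x) \<bullet> (A *v y) = (Q *v x) \<bullet> (Q *v y)" for x y
    using quad[of "x + y"] quad[of x] quad[of y]
    by (simp add: matrix_vector_right_distrib inner_add_left inner_add_right inner_commute)
  then have "x \<bullet> (A *v (A *v y)) = x \<bullet> (Q *v (Q *v y))" for x y
    using A Q by (simp add: pos_def_def symmetric_matrix_inner)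
  then have "A *v (A *v y) = Q *v (Q *v y)" for y
    by (metis vector_eq_ldot)
  then have "A ** A = Q ** Q"
    by (simp add: matrix_eq matrix_vector_mul_assoc)
  then show ?thesis
    using pos_def_square_inject[OF A Q] by simp
qed

end

section \<open>Block vectors and the quadratic form of the matrix inequality\<close>

text \<open>Splits the index type exactly as \<open>block3\<close> does, so that products can be
  computed block by block.\<close>

definition stack3 :: "real^'k \<Rightarrow> real \<Rightarrow> real^'k \<Rightarrow> real^('k + unit + 'k)" where
  "stack3 x s y = (\<chi> r. case r of Inl i \<Rightarrow> x $ i | Inr (Inl _) \<Rightarrow> s | Inr (Inr i) \<Rightarrow> y $ i)"

lemma stack3_exhaust:
  obtains x s y where "w = stack3 x s y"
proof
  show "w = stack3 (\<chi> i. w $ Inl i) (w $ Inr (Inl ())) (\<chi> i. w $ Inr (Inr i))"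
    by (auto simp: stack3_def vec_eq_iff split: sum.splits)
qed

lemma sum_UNIV_stack3:
  fixes f :: "'k::finite + unit + 'k \<Rightarrow> real"
  shows "sum f UNIV = (\<Sum>i\<in>UNIV. f (Inl i)) + f (Inr (Inl ())) + (\<Sum>i\<in>UNIV. f (Inr (Inr i)))"
  by (simp add: UNIV_Plus_UNIV[symmetric] sum.Plus UNIV_unit comp_def del: UNIV_Plus_UNIV)

lemma inner_stack3: "stack3 x s y \<bullet> stack3 x' s' y' = x \<bullet> x' + s * s' + y \<bullet> y'"
  by (simp add: inner_vec_def sum_UNIV_stack3 stack3_def)

lemma block3_mult_stack3:
  "block3 M11 v12 M13 v21 c22 v23 M31 v32 M33 *v stack3 x s y =
    stack3 (M11 *v x + s *\<^sub>R v12 + M13 *v y) (v21 \<bullet> x + c22 * s + v23 \<bullet> y)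
      (M31 *v x + s *\<^sub>R v32 + M33 *v y)"
  by (auto simp: vec_eq_iff matrix_vector_mult_def sum_UNIV_stack3 stack3_def block3_def
      inner_vec_def mult.commute split: sum.splits)

text \<open>Completes the square in \<open>y\<close>: the terms coming from \<open>A\<close>,
  \<open>b\<close> and the identity block become a difference of two squared norms, only the first
  of which involves \<open>y\<close>.\<close>

lemma sproc_matrix_quadratic_form:
  assumes A: "symmetric_matrix A" and Q: "symmetric_matrix Q"
  shows "stack3 x s y \<bullet> (sproc_matrix S t Q q A b mu lam *v stack3 x s y) =
    s * (mu \<bullet> (S *v x)) + s\<^sup>2 * (1 - mu \<bullet> t) + (norm (A *v x + s *\<^sub>R b + y))\<^sup>2
    - (norm (A *v x + s *\<^sub>R b))\<^sup>2 + lam * ((norm (Q *v x + s *\<^sub>R q))\<^sup>2 - s\<^sup>2)"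
proof -
  have 1: "x \<bullet> (mu v* S) = mu \<bullet> (S *v x)"
    by (simp add: dot_lmul_matrix inner_commute[of x])
  have 2: "(mu v* S) \<bullet> x = mu \<bullet> (S *v x)"
    by (rule dot_lmul_matrix)
  have 3: "(q v* Q) \<bullet> x = q \<bullet> (Q *v x)"
    by (rule dot_lmul_matrix)
  have 4: "x \<bullet> (A *v y) = y \<bullet> (A *v x)"
    using symmetric_matrix_inner[OF A, of x y] by (simp add: inner_commute)
  have 5: "x \<bullet> ((Q ** Q) *v x) = (Q *v x) \<bullet> (Q *v x)"
    by (simp add: symmetric_matrix_inner[OF Q] matrix_vector_mul_assoc)
  have 6: "x \<bullet> (Q *v q) = q \<bullet> (Q *v x)"
    using symmetric_matrix_inner[OF Q, of x q] by (simp add: inner_commute)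
  show ?thesis
    unfolding sproc_matrix_def
    by (simp add: matrix_vector_mult_add_rdistrib scaleR_matrix_vector_assoc[symmetric]
        block3_mult_stack3 inner_add_right inner_add_left inner_stack3 power2_norm_eq_inner 1 2 3 4 5 6)
      (simp add: algebra_simps power2_eq_square inner_commute 4)
qed

lemma symmetric_sproc_matrix:
  assumes A: "symmetric_matrix A" and Q: "symmetric_matrix Q"
  shows "symmetric_matrix (sproc_matrix S t Q q A b mu lam)"
proof -
  have a: "A $ i $ j = A $ j $ i" and b: "Q $ i $ j = Q $ j $ i" for i j
    using A Q unfolding symmetric_matrix_def by (metis transpose_def vec_lambda_beta)+
  have c: "(Q ** Q) $ i $ j = (Q ** Q) $ j $ i" for i j
    unfolding matrix_matrix_mult_def by (simp add: b mult.commute)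
  have d: "q v* Q = Q *v q"
    using Q unfolding symmetric_matrix_def by (metis vector_transpose_matrix)
  show ?thesis
    unfolding symmetric_matrix_def sproc_matrix_def transpose_matrix_vector
    by (auto simp: transpose_def vec_eq_iff block3_def d mat_def a c split: sum.splits)
qed

text \<open>For these multipliers everything in the quadratic form cancels except the square of the
  norm of \<open>Q x + s q + y\<close>.\<close>

lemma sproc_feasible_ellipsoid:
  assumes "symmetric_matrix Q"
  shows "sproc_feasible S t Q q Q q 0 1"
proof -
  have "0 \<le> w \<bullet> (sproc_matrix S t Q q Q q 0 1 *v w)" for w
  proof -
    obtain x s y where "w = stack3 x s y"
      by (rule stack3_exhaust)
    then show ?thesis
      by (simp add: sproc_matrix_quadratic_form assms)
  qed
  then show ?thesis
    by (simp add: sproc_feasible_def pos_semidef_def symmetric_sproc_matrix assms)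
qed

text \<open>The last block variable \<open>y\<close> is eliminated at its minimiser \<open>-(A x + s b)\<close>.\<close>

lemma sproc_feasible_reduced:
  assumes "sproc_feasible S t Q q A b mu lam" and "symmetric_matrix Q"
  shows "(norm (A *v x + s *\<^sub>R b))\<^sup>2 \<le>
    s * (mu \<bullet> (S *v x)) + s\<^sup>2 * (1 - mu \<bullet> t) + lam * ((norm (Q *v x + s *\<^sub>R q))\<^sup>2 - s\<^sup>2)"
proof -
  have A: "symmetric_matrix A"
    using assms(1) by (simp add: sproc_feasible_def)
  define y where "y = - (A *v x + s *\<^sub>R b)"
  have "0 \<le> stack3 x s y \<bullet> (sproc_matrix S t Q q A b mu lam *v stack3 x s y)"
    using assms(1) by (simp add: sproc_feasible_def pos_semidef_def)
  then show ?thesis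
    unfolding sproc_matrix_quadratic_form[OF A assms(2)] by (simp add: y_def)
qed

section \<open>Bounds satisfied by every feasible point\<close>

lemma ellipsoid_center_eq_0:
  assumes "pos_def Q"
  shows "Q *v ellipsoid_center Q q + q = 0"
  by (simp add: ellipsoid_center_def matrix_vector_mul_assoc linear_neg[OF matrix_vector_mul_linear]
      invertible_matrix_inv[OF pos_def_invertible[OF assms]])

text \<open>At the center with \<open>s = 1\<close> the ellipsoid term reduces to
  \<open>- lam\<close>, and the terms in \<open>mu\<close> are at most 0 because \<open>mu\<close>
  is nonnegative and the center lies in the polytope.\<close>

lemma sproc_feasible_multiplier_le:
  fixes mu :: "real^'j"
  assumes feas: "sproc_feasible S t Q q A b mu lam" and Q: "pos_def Q"
    and c: "ellipsoid_center Q q \<in> polytope_ineq S t"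
  shows "lam + (norm (A *v ellipsoid_center Q q + b))\<^sup>2 \<le> 1"
proof -
  let ?c = "ellipsoid_center Q q"
  have "(norm (A *v ?c + 1 *\<^sub>R b))\<^sup>2 \<le> mu \<bullet> (S *v ?c) + (1 - mu \<bullet> t) - lam"
    using sproc_feasible_reduced[OF feas, of ?c 1] Q ellipsoid_center_eq_0[OF Q, of q]
    by (simp add: pos_def_def)
  moreover have "mu \<bullet> (S *v ?c) \<le> mu \<bullet> t"
  proof -
    have "0 \<le> mu" "S *v ?c \<le> t"
      using feas c by (simp_all add: sproc_feasible_def polytope_ineq_def)
    then show ?thesis
      unfolding inner_vec_def by (intro sum_mono) (simp add: less_eq_vec_def mult_left_mono)
  qed
  ultimately show ?thesis by simp
qed

text \<open>Setting \<open>s = 0\<close> removes \<open>b\<close>, \<open>q\<close> and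
  \<open>mu\<close> from the reduced inequality, and the multiplier bound gives
  \<open>lam \<le> 1\<close>.\<close>

lemma sproc_feasible_norm_le:
  fixes A :: "real^'k^'k"
  assumes feas: "sproc_feasible S t Q q A b mu lam" and Q: "pos_def Q"
    and c: "ellipsoid_center Q q \<in> polytope_ineq S t"
  shows "norm (A *v x) \<le> norm (Q *v x)"
proof -
  have "lam \<le> 1"
    using sproc_feasible_multiplier_le[OF assms] by (smt (verit) zero_le_power2)
  then have "lam * (norm (Q *v x))\<^sup>2 \<le> (norm (Q *v x))\<^sup>2"
    using mult_right_mono[of lam 1 "(norm (Q *v x))\<^sup>2"] by simp
  moreover have "(norm (A *v x))\<^sup>2 \<le> lam * (norm (Q *v x))\<^sup>2"
    using sproc_feasible_reduced[OF feas, of x 0] Q by (simp add: pos_def_def)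
  ultimately show ?thesis
    by (auto intro: power2_le_imp_le[OF order_trans])
qed

theorem proposition1:
  fixes S :: "real^'k^'j" and t :: "real^'j"
    and Q :: "real^'k^'k" and q :: "real^'k"
  assumes "compact (polytope_ineq S t)"
    and "convex (polytope_ineq S t)"
    and "interior (polytope_ineq S t) \<noteq> {}"
    and "pos_def Q"
    and "polytope_ineq S t \<subseteq> ellipsoid Q q"
    and "ellipsoid_center Q q \<in> polytope_ineq S t"
  shows "sproc_ellipsoids S t Q q = {(Q, q)}"
proof -
  note Q = \<open>pos_def Q\<close> and c = \<open>ellipsoid_center Q q \<in> polytope_ineq S t\<close>
  have feasQ: "sproc_feasible S t Q q Q q 0 1"
    using Q by (simp add: pos_def_def sproc_feasible_ellipsoid)
  have bound: "neg_log_det Q \<le> neg_log_det A"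
    if "sproc_feasible S t Q q A b mu lam" for A b mu lam
  proof (cases "pos_def A")
    case True
    then show ?thesis
      using pos_def_det_mono[OF True Q sproc_feasible_norm_le[OF that Q c]] Q
        pos_def_det_pos[OF True] pos_def_det_pos[OF Q]
      by (simp add: neg_log_det_def)
  qed (simp add: neg_log_det_def)
  then have optQ: "sproc_optimal S t Q q Q q 0 1"
    using feasQ by (simp add: sproc_optimal_def)
  have "A = Q \<and> b = q" if opt: "sproc_optimal S t Q q A b mu lam" for A b mu lam
  proof -
    have feas: "sproc_feasible S t Q q A b mu lam"
      and le: "neg_log_det A \<le> neg_log_det Q"
      using opt feasQ unfolding sproc_optimal_def by blast+
    \<comment> \<open>The objective is finite at \<open>Q\<close>, so an optimal \<open>A\<close>
      cannot take the value infinity.\<close>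
    have A: "pos_def A"
      using le Q by (auto simp: neg_log_det_def split: if_splits)
    have "det Q \<le> det A"
      using le A Q pos_def_det_pos[OF A] pos_def_det_pos[OF Q] by (simp add: neg_log_det_def)
    then have AQ: "A = Q"
      using pos_def_det_mono[OF A Q sproc_feasible_norm_le[OF feas Q c]]
        pos_def_det_eq_imp_eq[OF A Q sproc_feasible_norm_le[OF feas Q c]] by simp
    \<comment> \<open>With \<open>A = Q\<close>, the inequality at \<open>s = 0\<close> and one
      nonzero vector forces \<open>1 \<le> lam\<close>. The bound at the center then leaves no room
      for its norm term, which determines \<open>b\<close>.\<close>
    obtain x :: "real^'k" where x: "norm x = 1"
      using norm_axis_1 by blast
    have "Q *v x \<noteq> 0"
      using Q x pos_def_inner_eq_0[OF Q, of x] by auto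
    moreover have "(norm (Q *v x))\<^sup>2 \<le> lam * (norm (Q *v x))\<^sup>2"
      using sproc_feasible_reduced[OF feas, of x 0] Q by (simp add: AQ pos_def_def)
    ultimately have "1 \<le> lam"
      by (simp add: mult_le_cancel_right1)
    then have "(norm (Q *v ellipsoid_center Q q + b))\<^sup>2 \<le> 0"
      using sproc_feasible_multiplier_le[OF feas Q c] unfolding AQ by linarith
    then have "Q *v ellipsoid_center Q q + b = 0"
      by simp
    then show ?thesis
      using ellipsoid_center_eq_0[OF Q, of q] AQ by (metis add_left_cancel)
  qed
  then show ?thesis
    using optQ unfolding sproc_ellipsoids_def by auto
qed

end
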